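(* Let $\{\mathcal A^{[s,t]}: 0\le s\le t\}$ be a stochastic flow of algebras. Then it does not contain an evolution algebra, i.e. $\mathcal A^{[s,t]}$ is not an evolution algebra for any $(s,t)$ with $0\le s\le t$.
   Context: Evolution algebra: an algebra over a field is called an evolution algebra if it admits a basis $e_1,e_2,\dots$ such that $e_i\cdot e_j=0$ for $i\ne j$ and $e_i\cdot e_i=\sum_k a_{ik}e_k$ for every $i$. Stochastic flow of algebras (SFA): consider a family $\{\mathcal A^{[s,t]}: 0\le s\le t\}$ of $m$-dimensional real algebras with basis $e_1,\dots,e_m$ and multiplication $e_ie_j=\sum_{k=1}^m P^{[s,t]}_{ij,k}e_k$. It is an SFA if $\{P^{[s,t]}_{ij,k}\}$ is a quadratic stochastic process of type (A) or of type (B), i.e. with some initial distribution $x^{(0)}\in S^{m-1}=\{x\in\mathbb R^m: x_i\ge 0,\ \sum_i x_i=1\}$ it satisfies: (1) $P^{[s,t]}_{ij,k}=P^{[s,t]}_{ji,k}$ for all $i,j,k$; (2) $P^{[s,t]}_{ij,k}\ge 0$ and $\sum_k P^{[s,t]}_{ij,k}=1$ for all $i,j,k$; (3) for all $s<r<t$ with $t-r\ge 1$ and $r-s\ge 1$, putting $x_k^{(r)}=\sum_{i,j}P^{[0,r]}_{ij,k}x_i^{(0)}x_j^{(0)}$, either (type (A)) $P^{[s,t]}_{ij,k}=\sum_{n,l}P^{[s,r]}_{ij,n}P^{[r,t]}_{nl,k}x^{(r)}_l$, or (type (B)) $P^{[s,t]}_{ij,k}=\sum_{n,l,g,h}P^{[s,r]}_{in,l}P^{[s,r]}_{jg,h}P^{[r,t]}_{lh,k}x^{(s)}_nx^{(s)}_g$.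 Conditions (1) and (2) are required for every pair $(s,t)$ with $0\le s\le t$.
   Formalization: The claim is proved for m ≥ 2 and with "evolution algebra" meaning that the flow's own basis e_1,...,e_m is a natural basis; for m = 1, or if any other basis is allowed (take all P_{ij,k} = 1/m), the claim is false. *)

theory Defs
  imports "HOL-Analysis.Analysis"
begin

definition basis_family :: "('i \<Rightarrow> 'a::real_vector) \<Rightarrow> bool" where
  "basis_family b \<longleftrightarrow> inj b \<and> independent (range b) \<and> span (range b) = UNIV"

(* An m-dimensional real algebra is a bilinear product on a real vector space 'a that has a basis
   indexed by a finite type 'm with m = CARD('m).  Being an evolution
   algebra is stated relative to a given basis, because in a stochastic flow of algebras the basis
   e is part of the data; having the two properties below for some other basis does not count.
   (If P^[s,t]_{ij,k} = 1/m throughout, then e_1 + ... + e_m together with any basis of the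
   vectors with coordinate sum 0 has them.) *)
definition evolution_algebra_wrt ::
    "('a::real_vector \<Rightarrow> 'a \<Rightarrow> 'a) \<Rightarrow> ('m::finite \<Rightarrow> 'a) \<Rightarrow> bool" where
  "evolution_algebra_wrt mul b \<longleftrightarrow>
     bilinear mul \<and> basis_family b \<and>
     (\<forall>i j. i \<noteq> j \<longrightarrow> mul (b i) (b j) = 0) \<and>
     (\<exists>a :: 'm \<Rightarrow> 'm \<Rightarrow> real. \<forall>i. mul (b i) (b i) = (\<Sum>k\<in>UNIV. a i k *\<^sub>R b k))"

definition distributions :: "(real ^ 'm::finite) set" where
  "distributions = {x. (\<forall>i. 0 \<le> x $ i) \<and> (\<Sum>i\<in>UNIV. x $ i) = 1}"

(* P s t i j k stands for P^[s,t]_{ij,k}.  At time 0 the distribution is x0 itself, whatever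
   P 0 0 is. *)
definition distr_at ::
    "(real \<Rightarrow> real \<Rightarrow> 'm \<Rightarrow> 'm \<Rightarrow> 'm \<Rightarrow> real) \<Rightarrow> real ^ 'm \<Rightarrow> real \<Rightarrow> real ^ 'm::finite" where
  "distr_at P x0 r =
     (if r = 0 then x0 else (\<chi> k. \<Sum>i\<in>UNIV. \<Sum>j\<in>UNIV. P 0 r i j k * x0 $ i * x0 $ j))"

definition type_A ::
    "(real \<Rightarrow> real \<Rightarrow> 'm::finite \<Rightarrow> 'm \<Rightarrow> 'm \<Rightarrow> real) \<Rightarrow> real ^ 'm \<Rightarrow> bool" where
  "type_A P x0 \<longleftrightarrow>
     (\<forall>s r t. 0 \<le> s \<longrightarrow> s < r \<longrightarrow> r < t \<longrightarrow> t - r \<ge> 1 \<longrightarrow> r - s \<ge> 1 \<longrightarrow>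
       (\<forall>i j k. P s t i j k =
         (\<Sum>n\<in>UNIV. \<Sum>l\<in>UNIV. P s r i j n * P r t n l k * distr_at P x0 r $ l)))"

definition type_B ::
    "(real \<Rightarrow> real \<Rightarrow> 'm::finite \<Rightarrow> 'm \<Rightarrow> 'm \<Rightarrow> real) \<Rightarrow> real ^ 'm \<Rightarrow> bool" where
  "type_B P x0 \<longleftrightarrow>
     (\<forall>s r t. 0 \<le> s \<longrightarrow> s < r \<longrightarrow> r < t \<longrightarrow> t - r \<ge> 1 \<longrightarrow> r - s \<ge> 1 \<longrightarrow>
       (\<forall>i j k. P s t i j k =
         (\<Sum>n\<in>UNIV. \<Sum>l\<in>UNIV. \<Sum>g\<in>UNIV. \<Sum>h\<in>UNIV.
            P s r i n l * P s r j g h * P r t l h k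
              * distr_at P x0 s $ n * distr_at P x0 s $ g)))"

definition quadratic_stochastic_process ::
    "(real \<Rightarrow> real \<Rightarrow> 'm::finite \<Rightarrow> 'm \<Rightarrow> 'm \<Rightarrow> real) \<Rightarrow> real ^ 'm \<Rightarrow> bool" where
  "quadratic_stochastic_process P x0 \<longleftrightarrow>
     x0 \<in> distributions \<and>
     (\<forall>s t. 0 \<le> s \<longrightarrow> s \<le> t \<longrightarrow>
       (\<forall>i j k. P s t i j k = P s t j i k) \<and>
       (\<forall>i j k. 0 \<le> P s t i j k) \<and>
       (\<forall>i j. (\<Sum>k\<in>UNIV. P s t i j k) = 1)) \<and>
     (type_A P x0 \<or> type_B P x0)"

(* A s t is the product of the algebra A^[s,t]; only its values for 0 \<le> s \<le> t matter. *)
definition stochastic_flow_of_algebras ::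
    "(real \<Rightarrow> real \<Rightarrow> 'a::real_vector \<Rightarrow> 'a \<Rightarrow> 'a) \<Rightarrow> ('m::finite \<Rightarrow> 'a) \<Rightarrow> bool" where
  "stochastic_flow_of_algebras A e \<longleftrightarrow>
     basis_family e \<and>
     (\<exists>P x0. quadratic_stochastic_process P x0 \<and>
       (\<forall>s t. 0 \<le> s \<longrightarrow> s \<le> t \<longrightarrow>
         bilinear (A s t) \<and>
         (\<forall>i j. A s t (e i) (e j) = (\<Sum>k\<in>UNIV. P s t i j k *\<^sub>R e k))))"

end

theory Submission
  imports Defs
begin

text \<open>
  In a stochastic flow the coordinates of every product \<open>e i \<cdot> e j\<close> add up to 1, so by
  linear independence such a product is never zero. An evolution algebra requires
  \<open>e i \<cdot> e j = 0\<close> as soon as \<open>i \<noteq> j\<close>, and in dimension at least 2 there is such a pair.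
\<close>

lemma basis_family_coord_eq_0:
  fixes b :: "'m::finite \<Rightarrow> 'a::real_vector"
  assumes "basis_family b" and zero: "(\<Sum>k\<in>UNIV. c k *\<^sub>R b k) = 0"
  shows "c k = 0"
proof -
  have inj: "inj b" and ind: "independent (range b)"
    using assms(1) by (auto simp: basis_family_def)
  have "(\<Sum>v\<in>range b. c (inv b v) *\<^sub>R v) = 0"
    using zero by (simp add: sum.reindex[OF inj] inv_f_f[OF inj])
  then have "c (inv b (b k)) = 0"
    using independentD[OF ind, of "range b" "\<lambda>v. c (inv b v)" "b k"] by simp
  then show ?thesis
    by (simp add: inv_f_f[OF inj])
qed

theorem proposition10:
  fixes A :: "real \<Rightarrow> real \<Rightarrow> 'a::real_vector \<Rightarrow> 'a \<Rightarrow> 'a"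
    and e :: "'m::finite \<Rightarrow> 'a"
  assumes "CARD('m) \<ge> 2"
    and "stochastic_flow_of_algebras A e"
  shows "\<forall>s t. 0 \<le> s \<longrightarrow> s \<le> t \<longrightarrow> \<not> evolution_algebra_wrt (A s t) e"
proof (intro allI impI notI)
  fix s t :: real
  assume st: "0 \<le> s" "s \<le> t" and evol: "evolution_algebra_wrt (A s t) e"
  obtain i j :: 'm where "i \<noteq> j"
    using assms(1) by (meson UNIV_I card_2_iff' ex_card subsetD)
  obtain P x0 where basis: "basis_family e" and qsp: "quadratic_stochastic_process P x0"
    and "A s t (e i) (e j) = (\<Sum>k\<in>UNIV. P s t i j k *\<^sub>R e k)"
    using assms(2) st unfolding stochastic_flow_of_algebras_def by blast
  moreover have "A s t (e i) (e j) = 0"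
    using evol \<open>i \<noteq> j\<close> by (simp add: evolution_algebra_wrt_def)
  ultimately have "P s t i j k = 0" for k
    by (intro basis_family_coord_eq_0[OF basis]) simp
  moreover have "(\<Sum>k\<in>UNIV. P s t i j k) = 1"
    using qsp st unfolding quadratic_stochastic_process_def by blast
  ultimately show False
    by simp
qed

end
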